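(* Let $p$ be a natural number. If $\Omega\subset\mathbb{C}$ is a smooth bounded simply connected one-point quadrature domain for the boundary measure $|z|^{-2p}dz$, with $0\in\Omega$ but $0$ not the quadrature node, then $\Omega$ is the conformal image of the unit disc $\mathbb{D}$ under a map of one of the following two forms: $$\varphi(t)=t\left(\frac{a+bt}{1-t\overline{\zeta}_0}\right)^{1/p},$$ where $a,b$ are complex constants with $|a|>|b|$ and $\zeta_0\in\mathbb{D}$; or $$\varphi(t)=t\left(\frac{a+bt+ct^2}{1-t\overline{\zeta}_0}\right)^{1/p},$$ where $a,b,c$ are complex constants such that all roots of $a+bt+ct^2$ have modulus greater than $1$, and $\zeta_0\in\mathbb{D}$. In each case the $p$th root denotes an analytic branch on $\mathbb{D}$.
   Context: Natural numbers are $1,2,3,\dots$; a smooth bounded domain is a bounded connected open set with $\mathcal{C}^\infty$ smooth boundary, and $\partial\Omega$ is positively oriented. $\mathcal{A}^\infty(\Omega)$ is the space of analytic functions on $\Omega$ that are $\mathcal{C}^\infty$ smooth up to the boundary. $\Omega$ is a one-point quadrature domain with respect to the boundary measure $|z|^{-2p}dz$ with quadrature node $z_0\in\Omega$ if there is a constant $c_0\in\mathbb{C}$ such that $\int_{\partial\Omega}f(z)|z|^{-2p}dz=c_0\,f(z_0)$ for all $f\in\mathcal{A}^\infty(\Omega)$. *)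

theory Defs
  imports "HOL-Complex_Analysis.Complex_Analysis"
begin

text \<open>A \<open>C\<^sup>\<infinity>\<close> smooth regular Jordan curve, given as a 1-periodic function on the whole real
  line, so that smoothness also holds at the base point of the path on \<open>[0,1]\<close>.\<close>

definition smooth_Jordan_curve :: "(real \<Rightarrow> complex) \<Rightarrow> bool" where
  "smooth_Jordan_curve \<gamma> \<longleftrightarrow>
     (\<forall>t. \<gamma> (t + 1) = \<gamma> t) \<and>
     simple_path \<gamma> \<and>
     (\<forall>n t. ((\<lambda>g s. vector_derivative g (at s)) ^^ n) \<gamma> differentiable (at t)) \<and>
     (\<forall>t. vector_derivative \<gamma> (at t) \<noteq> 0)"

text \<open>The boundary consists of finitely many disjoint smooth Jordan curves, each oriented so that
  the domain lies to the left, i.e. the normal \<open>\<i> \<gamma>'(t)\<close> points into the domain.\<close>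

definition positive_boundary_param :: "complex set \<Rightarrow> (real \<Rightarrow> complex) set \<Rightarrow> bool" where
  "positive_boundary_param \<Omega> \<Gamma> \<longleftrightarrow>
     finite \<Gamma> \<and>
     (\<forall>\<gamma>\<in>\<Gamma>. smooth_Jordan_curve \<gamma>) \<and>
     disjoint_family_on path_image \<Gamma> \<and>
     frontier \<Omega> = (\<Union>\<gamma>\<in>\<Gamma>. path_image \<gamma>) \<and>
     (\<forall>\<gamma>\<in>\<Gamma>. \<forall>t. \<forall>\<^sub>F s in at_right (0::real).
        \<gamma> t + of_real s * (\<i> * vector_derivative \<gamma> (at t)) \<in> \<Omega>)"

definition smooth_bounded_domain :: "complex set \<Rightarrow> bool" where
  "smooth_bounded_domain \<Omega> \<longleftrightarrow>
     open \<Omega> \<and> connected \<Omega> \<and> \<Omega> \<noteq> {} \<and> bounded \<Omega> \<and> (\<exists>\<Gamma>. positive_boundary_param \<Omega> \<Gamma>)"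

text \<open>The integral does not depend on the chosen positively oriented parametrization.\<close>

definition boundary_integral :: "complex set \<Rightarrow> (complex \<Rightarrow> complex) \<Rightarrow> complex" where
  "boundary_integral \<Omega> g =
     (\<Sum>\<gamma>\<in>(SOME \<Gamma>. positive_boundary_param \<Omega> \<Gamma>). contour_integral \<gamma> g)"

text \<open>Holomorphic functions all of whose derivatives extend continuously to the closure (the
  partial derivatives of a holomorphic function are unimodular multiples of the complex ones).
  On the boundary, \<open>f\<close> itself is the continuous extension of its values inside; its values
  outside the closure are irrelevant.\<close>

definition A_infinity :: "complex set \<Rightarrow> (complex \<Rightarrow> complex) set" where
  "A_infinity \<Omega> =
     {f. f holomorphic_on \<Omega> \<and> continuous_on (closure \<Omega>) f \<and>
         (\<forall>n. \<exists>F. continuous_on (closure \<Omega>) F \<and> (\<forall>z\<in>\<Omega>. F z = (deriv ^^ n) f z))}"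

definition one_point_quadrature_domain :: "nat \<Rightarrow> complex set \<Rightarrow> complex \<Rightarrow> bool" where
  "one_point_quadrature_domain p \<Omega> z0 \<longleftrightarrow>
     z0 \<in> \<Omega> \<and>
     (\<exists>c0. \<forall>f\<in>A_infinity \<Omega>.
        boundary_integral \<Omega> (\<lambda>z. f z / of_real (norm z ^ (2 * p))) = c0 * f z0)"

definition conformal_map_onto :: "(complex \<Rightarrow> complex) \<Rightarrow> complex set \<Rightarrow> complex set \<Rightarrow> bool" where
  "conformal_map_onto \<phi> S T \<longleftrightarrow> \<phi> holomorphic_on S \<and> bij_betw \<phi> S T"

definition analytic_root_branch ::
    "nat \<Rightarrow> complex set \<Rightarrow> (complex \<Rightarrow> complex) \<Rightarrow> (complex \<Rightarrow> complex) \<Rightarrow> bool" where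
  "analytic_root_branch p S h r \<longleftrightarrow> r holomorphic_on S \<and> (\<forall>t\<in>S. r t ^ p = h t)"

end

theory Submission
  imports Defs
begin

text \<open>Put \<open>g(z) = |z|\<^bsup>-2p\<^esup>\<close>. Testing the quadrature identity with \<open>1/(z - w)\<close>, \<open>w\<close> outside the closure
  of \<open>\<Omega>\<close>, shows that the Cauchy transform of \<open>g\<close> along the boundary equals \<open>c\<^sub>0/(z\<^sub>0 - w)\<close> outside
  \<open>\<Omega>\<close>. Since the transform jumps by \<open>2\<pi>\<i>g\<close> across the boundary, there is a meromorphic function \<open>H\<close>
  on \<open>\<Omega>\<close>, with at most a simple pole at \<open>z\<^sub>0\<close>, such that \<open>H(w) - g(w)\<close> tends to 0 at the boundary.
  Neither the orientation of the curve (only the sign of the jump) nor the boundary behaviour of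
  the Riemann map matters for this.

  Let \<open>\<phi>\<close> be the Riemann map with \<open>\<phi>(0) = 0\<close> and \<open>\<phi>(\<zeta>\<^sub>0) = z\<^sub>0\<close>. As \<open>H \<circ> \<phi>\<close> is asymptotically real at the
  circle, subtracting its principal part together with the reflection of that part leaves a real
  constant, so \<open>H \<circ> \<phi>\<close> is explicit and on the circle has the form \<open>(\<beta> + 2 Re(\<alpha>\<^sup>* t)) / |1 - \<zeta>\<^sub>0\<^sup>* t|\<^sup>2\<close>
  with \<open>*\<close> denoting conjugation. It is positive there, hence equals \<open>C |1 - \<zeta>\<^sub>1\<^sup>* t|\<^sup>2 / |1 - \<zeta>\<^sub>0\<^sup>* t|\<^sup>2\<close>
  with \<open>|\<zeta>\<^sub>1| < 1\<close>. Therefore the zero-free function \<open>(\<phi>(t)/t)\<^sup>p (1 - \<zeta>\<^sub>1\<^sup>* t) / (1 - \<zeta>\<^sub>0\<^sup>* t)\<close> has constant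
  boundary modulus and is constant. In particular the first of the two forms always occurs.\<close>

section \<open>Smooth Jordan curves and boundary values of Cauchy transforms\<close>

lemma smooth_Jordan_curveD:
  assumes "smooth_Jordan_curve \<gamma>"
  shows "simple_path \<gamma>" "pathfinish \<gamma> = pathstart \<gamma>" "\<gamma> C1_differentiable_on {0..1}"
proof -
  have d: "((\<lambda>g s. vector_derivative g (at s)) ^^ n) \<gamma> differentiable (at t)" for n t
    using assms by (auto simp: smooth_Jordan_curve_def)
  have "\<gamma> differentiable (at t)" "(\<lambda>s. vector_derivative \<gamma> (at s)) differentiable (at t)" for t
    using d[of 0 t] d[of 1 t] by simp_all
  then show "\<gamma> C1_differentiable_on {0..1}"
    by (simp add: C1_differentiable_on_eq differentiable_on_def differentiable_at_withinI
        differentiable_imp_continuous_on)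
  show "simple_path \<gamma>"
    using assms by (simp add: smooth_Jordan_curve_def)
  have "\<gamma> (0 + 1) = \<gamma> 0"
    using assms unfolding smooth_Jordan_curve_def by blast
  then show "pathfinish \<gamma> = pathstart \<gamma>"
    by (simp add: pathfinish_def pathstart_def)
qed

lemma C1_differentiable_on_imp_path:
  fixes \<gamma> :: "real \<Rightarrow> complex"
  assumes "\<gamma> C1_differentiable_on {0..1}"
  shows "valid_path \<gamma>" "continuous_on {0..1} \<gamma>"
    "continuous_on {0..1} (\<lambda>t. vector_derivative \<gamma> (at t))"
proof -
  show "valid_path \<gamma>"
    by (simp add: assms C1_differentiable_imp_piecewise valid_path_def)
  then show "continuous_on {0..1} \<gamma>"
    using valid_path_imp_path path_def by blast
  show "continuous_on {0..1} (\<lambda>t. vector_derivative \<gamma> (at t))"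
    using assms by (simp add: C1_differentiable_on_eq)
qed

lemma C1_differentiable_on_bounded_derivative:
  fixes \<gamma> :: "real \<Rightarrow> complex"
  assumes "\<gamma> C1_differentiable_on {0..1}"
  obtains B where "\<And>t. t \<in> {0..1} \<Longrightarrow> norm (vector_derivative \<gamma> (at t)) \<le> B"
proof -
  have "bounded ((\<lambda>t. vector_derivative \<gamma> (at t)) ` {0..1})"
    by (intro compact_imp_bounded compact_continuous_image compact_Icc
        C1_differentiable_on_imp_path assms)
  then have "\<exists>B. \<forall>x\<in>(\<lambda>t. vector_derivative \<gamma> (at t)) ` {0..1}. norm x \<le> B"
    by (simp only: bounded_iff)
  then show ?thesis
    using that by (simp only: ball_simps) blast
qed

text \<open>A simple path can identify only the parameters 0 and 1, so at most one further parameter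
  reaches \<open>\<zeta>\<close>. This yields the null set on which the limiting Cauchy integrand is
  singular.\<close>

lemma finite_simple_path_preimage:
  assumes "simple_path \<gamma>"
  shows "finite {t \<in> {0..1}. \<gamma> t = \<zeta>}"
proof (cases "\<exists>t\<in>{0..1}. \<gamma> t = \<zeta>")
  case True
  then obtain t where "t \<in> {0..1}" "\<gamma> t = \<zeta>" by blast
  then have "{t \<in> {0..1}. \<gamma> t = \<zeta>} \<subseteq> {0, 1, t}"
    using assms unfolding simple_path_def loop_free_def by blast
  then show ?thesis
    by (meson finite.emptyI finite.insertI finite_subset)
next
  case False
  then have "{t \<in> {0..1}. \<gamma> t = \<zeta>} = {}" by blast
  then show ?thesis by (simp only: finite.emptyI)
qed

text \<open>Subtracting the value of \<open>g\<close> at the point of the curve nearest to \<open>w n\<close> makes the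
  integrand bounded uniformly in \<open>n\<close>, whatever the direction of approach, so that dominated
  convergence applies.\<close>

lemma Cauchy_transform_limit:
  fixes g :: "complex \<Rightarrow> complex"
  assumes C1: "\<gamma> C1_differentiable_on {0..1}" and sp: "simple_path \<gamma>"
    and lip: "L-lipschitz_on (path_image \<gamma>) g"
    and \<zeta>: "\<zeta> \<in> path_image \<gamma>"
    and w: "\<And>n. w n \<notin> path_image \<gamma>" "w \<longlonglongrightarrow> \<zeta>"
    and k: "\<And>n. winding_number \<gamma> (w n) = k"
  shows "(\<lambda>n. contour_integral \<gamma> (\<lambda>z. g z / (z - w n))) \<longlonglongrightarrow>
           2 * pi * \<i> * k * g \<zeta> + contour_integral \<gamma> (\<lambda>z. (g z - g \<zeta>) / (z - \<zeta>))"
proof -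
  define P where "P = path_image \<gamma>"
  have cg: "continuous_on P g"
    using lip lipschitz_on_continuous_on P_def by blast
  note vp = C1_differentiable_on_imp_path(1)[OF C1]
    and c\<gamma> = C1_differentiable_on_imp_path(2)[OF C1]
    and cd = C1_differentiable_on_imp_path(3)[OF C1]
  obtain B where B: "\<And>t. t \<in> {0..1} \<Longrightarrow> norm (vector_derivative \<gamma> (at t)) \<le> B"
    by (rule C1_differentiable_on_bounded_derivative[OF C1]) blast
  have Pc: "closed P" "P \<noteq> {}"
    unfolding P_def using closed_valid_path_image[OF vp] \<zeta> by blast+
  have "\<exists>c. c \<in> P \<and> (\<forall>z\<in>P. dist (w n) c \<le> dist (w n) z)" for n
    by (rule distance_attains_inf[OF Pc, of "w n"]) blast
  then have "\<exists>c. \<forall>n. c n \<in> P \<and> (\<forall>z\<in>P. dist (w n) (c n) \<le> dist (w n) z)"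
    by (intro choice allI)
  then obtain c where c: "\<And>n. c n \<in> P" "\<And>n z. z \<in> P \<Longrightarrow> dist (w n) (c n) \<le> dist (w n) z"
    by blast
  \<comment> \<open>The point \<open>\<zeta>\<close> itself competes for the minimal distance to
    \<open>w n\<close>, so the nearest points \<open>c n\<close> converge to \<open>\<zeta>\<close>
    along with \<open>w n\<close>.\<close>
  have "dist (c n) \<zeta> \<le> 2 * dist (w n) \<zeta>" for n
    using c(2)[of \<zeta> n] \<zeta> dist_triangle[of "c n" \<zeta> "w n"] by (simp add: P_def dist_commute)
  moreover have "(\<lambda>n. 2 * dist (w n) \<zeta>) \<longlonglongrightarrow> 0"
    using tendsto_mult[OF tendsto_const tendsto_dist[OF w(2) tendsto_const], of 2 \<zeta>] by simp
  ultimately have "(\<lambda>n. dist (c n) \<zeta>) \<longlonglongrightarrow> 0"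
    using tendsto_sandwich[of "\<lambda>_. 0" "\<lambda>n. dist (c n) \<zeta>" sequentially "\<lambda>n. 2 * dist (w n) \<zeta>"]
    by auto
  then have c\<zeta>: "c \<longlonglongrightarrow> \<zeta>"
    by (subst tendsto_dist_iff)
  have gc: "(\<lambda>n. g (c n)) \<longlonglongrightarrow> g \<zeta>"
    using continuous_on_tendsto_compose[OF cg c\<zeta>] \<zeta> c(1) by (simp add: P_def)
  have L0: "0 \<le> L" using lip lipschitz_on_nonneg by blast

  define f where "f n = (\<lambda>t. (g (\<gamma> t) - g (c n)) / (\<gamma> t - w n) * vector_derivative \<gamma> (at t))" for n
  define f' where "f' = (\<lambda>t. (g (\<gamma> t) - g \<zeta>) / (\<gamma> t - \<zeta>) * vector_derivative \<gamma> (at t))"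
  define N where "N = {t \<in> {0..1}. \<gamma> t = \<zeta>}"
  have N: "finite N"
    unfolding N_def by (rule finite_simple_path_preimage[OF sp])
  have in_P: "\<gamma> t \<in> P" if "t \<in> {0..1}" for t
    using that by (simp add: P_def path_image_def)
  have cgg: "continuous_on {0..1} (\<lambda>t. g (\<gamma> t))"
    by (rule continuous_on_compose2[OF cg c\<gamma>]) (use in_P in blast)
  have nz: "\<gamma> t - w n \<noteq> 0" if "t \<in> {0..1}" for t n
    using in_P[OF that] w(1)[of n] by (auto simp: P_def)
  have fi: "f n integrable_on {0..1}" for n
    unfolding f_def using nz
    by (intro integrable_continuous_interval continuous_intros cgg c\<gamma> cd) auto
  \<comment> \<open>By minimality of \<open>c n\<close>, the distance from \<open>\<gamma> t\<close>
    to \<open>c n\<close> is at most twice its distance to \<open>w n\<close>; the Lipschitz bound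
    on the numerator therefore cancels the denominator.\<close>
  have bd: "norm (f n t) \<le> 2 * L * B" if "t \<in> {0..1}" for n t
  proof -
    have "norm (g (\<gamma> t) - g (c n)) \<le> L * norm (\<gamma> t - c n)"
      using lipschitz_onD[OF lip, of "\<gamma> t" "c n"] in_P[OF that] c(1) by (simp add: P_def dist_norm)
    also have "\<dots> \<le> L * (2 * norm (\<gamma> t - w n))"
      using L0 c(2)[OF in_P[OF that], of n] dist_triangle[of "\<gamma> t" "c n" "w n"]
      by (intro mult_left_mono) (simp_all add: dist_norm norm_minus_commute)
    finally have "norm (g (\<gamma> t) - g (c n)) \<le> 2 * L * norm (\<gamma> t - w n)"
      by simp
    then have "norm ((g (\<gamma> t) - g (c n)) / (\<gamma> t - w n)) \<le> 2 * L"
      using nz[OF that] by (simp add: norm_divide divide_le_eq)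
    then show ?thesis
      unfolding f_def norm_mult using B[OF that] L0 by (intro mult_mono) auto
  qed
  have lim: "(\<lambda>n. f n t) \<longlonglongrightarrow> f' t" if "t \<in> {0..1} - N" for t
    unfolding f_def f'_def using that by (intro tendsto_intros gc w(2)) (auto simp: N_def)
  have neg: "negligible N"
    using N by (rule negligible_finite)
  have neg': "negligible (({0..1} - ({0..1} - N)) \<union> (({0..1} - N) - {0..1}))"
    by (rule negligible_subset[OF neg]) blast
  have spike: "integral ({0..1} - N) h = integral {0..1} h" for h :: "real \<Rightarrow> complex"
    by (rule integral_subset_negligible) (use negligible_subset[OF neg, of "{0..1} - ({0..1} - N)"] in blast)+
  \<comment> \<open>Pointwise convergence is known away from the finite set \<open>N\<close>, where
    the limit integrand divides by 0; the set is removed before dominated convergence and restored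
    by \<open>spike\<close>.\<close>
  have "(\<lambda>n. integral ({0..1} - N) (f n)) \<longlonglongrightarrow> integral ({0..1} - N) f'"
  proof (rule dominated_convergence(2)[where h = "\<lambda>_. 2 * L * B"])
    show "f n integrable_on {0..1} - N" for n
      using fi neg' integrable_spike_set_eq by blast
    show "(\<lambda>_. 2 * L * B) integrable_on {0..1} - N"
      using integrable_const_ivl[of "2 * L * B"] neg' integrable_spike_set_eq by blast
  qed (use bd lim in auto)
  then have "(\<lambda>n. integral {0..1} (f n)) \<longlonglongrightarrow> contour_integral \<gamma> (\<lambda>z. (g z - g \<zeta>) / (z - \<zeta>))"
    by (simp add: spike contour_integral_integral f'_def)
  \<comment> \<open>The subtracted constant \<open>g (c n)\<close> integrates to a multiple of the
    winding number, and its limit is the term that depends on the side of approach.\<close>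
  moreover have "integral {0..1} (f n) =
      contour_integral \<gamma> (\<lambda>z. g z / (z - w n)) - 2 * pi * \<i> * k * g (c n)" for n
  proof -
    have i1: "(\<lambda>z. g z / (z - w n)) contour_integrable_on \<gamma>"
      unfolding contour_integrable_on using nz
      by (intro integrable_continuous_interval continuous_intros cgg c\<gamma> cd) auto
    have i2: "((\<lambda>z. g (c n) * (1 / (z - w n))) has_contour_integral
                 g (c n) * (2 * pi * \<i> * winding_number \<gamma> (w n))) \<gamma>"
      by (intro has_contour_integral_lmul has_contour_integral_winding_number vp w(1))
    have "integral {0..1} (f n) = contour_integral \<gamma> (\<lambda>z. g z / (z - w n) - g (c n) * (1 / (z - w n)))"
      by (simp add: contour_integral_integral f_def diff_divide_distrib)
    also have "\<dots> = contour_integral \<gamma> (\<lambda>z. g z / (z - w n))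
        - contour_integral \<gamma> (\<lambda>z. g (c n) * (1 / (z - w n)))"
      using i1 i2 by (intro contour_integral_diff) (auto simp: contour_integrable_on_def)
    also have "contour_integral \<gamma> (\<lambda>z. g (c n) * (1 / (z - w n))) = 2 * pi * \<i> * k * g (c n)"
      using contour_integral_unique[OF i2] by (simp add: k)
    finally show ?thesis .
  qed
  ultimately have lim1: "(\<lambda>n. contour_integral \<gamma> (\<lambda>z. g z / (z - w n)) - 2 * pi * \<i> * k * g (c n))
      \<longlonglongrightarrow> contour_integral \<gamma> (\<lambda>z. (g z - g \<zeta>) / (z - \<zeta>))"
    by simp
  have "(\<lambda>n. 2 * pi * \<i> * k * g (c n)) \<longlonglongrightarrow> 2 * pi * \<i> * k * g \<zeta>"
    by (intro tendsto_intros gc)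
  from tendsto_add[OF this lim1] show ?thesis by simp
qed

text \<open>A compact set avoiding 0 keeps a distance \<open>m > 0\<close> from it. The real
  function \<open>x\<close> to the power \<open>-n\<close> has bounded derivative on
  \<open>{m..}\<close>, and composing with the norm, which is 1-Lipschitz, preserves the
  constant.\<close>

lemma lipschitz_on_inverse_norm_power:
  fixes P :: "complex set"
  assumes "compact P" "0 \<notin> P"
  obtains L where "L-lipschitz_on P (\<lambda>z. 1 / of_real (norm z ^ n) :: complex)"
proof -
  obtain m where m: "m > 0" "\<And>z. z \<in> P \<Longrightarrow> m \<le> norm z"
  proof (cases "P = {}")
    case True
    then show ?thesis using that[of 1] by simp
  next
    case False
    then obtain a where a: "a \<in> P" "\<And>z. z \<in> P \<Longrightarrow> norm a \<le> norm z"
      using continuous_attains_inf[OF assms(1) False continuous_on_norm_id] by blast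
    then show ?thesis using that[of "norm a"] assms(2) by force
  qed
  \<comment> \<open>The absolute value of the derivative at \<open>m\<close>, where it is largest on
    \<open>{m..}\<close>. For \<open>n = 0\<close> the truncated exponent is harmless because the
    factor \<open>real n\<close> vanishes.\<close>
  define L where "L = real n * inverse m ^ (n - 1) * (inverse m * inverse m)"
  have G: "\<bar>1 / x ^ n - 1 / y ^ n\<bar> \<le> L * \<bar>x - y\<bar>" if "x \<in> {m..}" "y \<in> {m..}" for x y :: real
  proof -
    have "norm (inverse x ^ n - inverse y ^ n) \<le> L * norm (x - y)"
    proof (rule field_differentiable_bound[of "{m..}"])
      fix z assume z: "z \<in> {m..}"
      then have "z \<noteq> 0" and le: "inverse z \<le> inverse m" "0 \<le> inverse z"
        using m(1) by auto
      then show "((\<lambda>x. inverse x ^ n) has_field_derivative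
          - (real n * inverse z ^ (n - 1) * (inverse z * inverse z))) (at z within {m..})"
        by (auto intro!: derivative_eq_intros)
      have "real n * inverse z ^ (n - 1) * (inverse z * inverse z) \<le> L"
        unfolding L_def
        by (rule mult_mono[OF mult_left_mono[OF power_mono[OF le]] mult_mono[OF le(1,1)]])
          (use le m(1) in auto)
      then show "norm (- (real n * inverse z ^ (n - 1) * (inverse z * inverse z))) \<le> L"
        using le(2) by (simp add: abs_mult)
    qed (use that in auto)
    then show ?thesis by (simp add: divide_inverse power_inverse)
  qed
  have "L-lipschitz_on P (\<lambda>z. 1 / of_real (norm z ^ n) :: complex)"
  proof (rule lipschitz_onI)
    show "0 \<le> L"
      unfolding L_def by (intro mult_nonneg_nonneg zero_le_power) (use m(1) in auto)
    fix z w assume zw: "z \<in> P" "w \<in> P"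
    have "1 / of_real (norm z ^ n) - 1 / of_real (norm w ^ n) =
        (of_real (1 / norm z ^ n - 1 / norm w ^ n) :: complex)"
      by simp
    then have "dist (1 / of_real (norm z ^ n) :: complex) (1 / of_real (norm w ^ n))
        = \<bar>1 / norm z ^ n - 1 / norm w ^ n\<bar>"
      unfolding dist_norm by (metis norm_of_real)
    also have "\<dots> \<le> L * \<bar>norm z - norm w\<bar>"
      using G m(2) zw by simp
    also have "\<dots> \<le> L * dist z w"
      using \<open>0 \<le> L\<close> by (intro mult_left_mono) (auto simp: dist_norm norm_triangle_ineq3)
    finally show "dist (1 / of_real (norm z ^ n) :: complex) (1 / of_real (norm w ^ n)) \<le> L * dist z w" .
  qed
  then show ?thesis using that by blast
qed

section \<open>Limits at the boundary of the unit disc\<close>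

text \<open>Approach to the circle from inside, uniformly in the argument. It expresses boundary
  conditions for functions that carry no values on the circle itself.\<close>

definition disc_boundary :: "complex filter" where
  "disc_boundary = filtercomap norm (at_left 1)"

lemma eventually_disc_boundary:
  "eventually P disc_boundary \<longleftrightarrow> (\<exists>\<delta><1. \<forall>t. \<delta> < norm t \<and> norm t < 1 \<longrightarrow> P t)"
proof
  assume "eventually P disc_boundary"
  then obtain Q where Q: "eventually Q (at_left (1::real))" "\<And>t. Q (norm t) \<Longrightarrow> P t"
    unfolding disc_boundary_def eventually_filtercomap by blast
  from Q(1) obtain \<delta> where "\<delta> < 1" "\<And>y. \<delta> < y \<Longrightarrow> y < 1 \<Longrightarrow> Q y"
    unfolding eventually_at_left_field by blast
  then show "\<exists>\<delta><1. \<forall>t. \<delta> < norm t \<and> norm t < 1 \<longrightarrow> P t"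
    using Q(2) by blast
next
  assume "\<exists>\<delta><1. \<forall>t. \<delta> < norm t \<and> norm t < 1 \<longrightarrow> P t"
  then obtain \<delta> where \<delta>: "\<delta> < 1" "\<And>t. \<delta> < norm t \<Longrightarrow> norm t < 1 \<Longrightarrow> P t" by blast
  have "eventually (\<lambda>y. \<delta> < y \<and> y < 1) (at_left (1::real))"
    unfolding eventually_at_left_field using \<delta>(1) by blast
  then show "eventually P disc_boundary"
    unfolding disc_boundary_def eventually_filtercomap using \<delta>(2) by blast
qed

lemma eventually_disc_boundary_norm:
  assumes "r < 1"
  shows "eventually (\<lambda>t. r < norm t \<and> norm t < 1) disc_boundary"
  unfolding eventually_disc_boundary using assms by blast

text \<open>Restricts a uniform boundary limit to a single radius, which gives information at one
  boundary point \<open>\<tau>\<close>.\<close>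

lemma filterlim_disc_boundary_radial:
  assumes "norm \<tau> = 1"
  shows "filterlim (\<lambda>r. of_real r * \<tau>) disc_boundary (at_left 1)"
  unfolding disc_boundary_def filterlim_filtercomap_iff
proof (rule filterlim_mono_eventually[OF filterlim_ident order_refl order_refl])
  have "eventually (\<lambda>r. 0 < r) (at_left (1::real))"
    unfolding eventually_at_left_field by (rule exI[of _ 0]) simp
  then show "eventually (\<lambda>r. r = (norm \<circ> (\<lambda>r. of_real r * \<tau>)) r) (at_left (1::real))"
    by eventually_elim (simp add: norm_mult assms)
qed

text \<open>Uniform continuity on the compact closed annulus compares \<open>k t\<close> with its
  value 0 at the radial projection \<open>sgn t\<close>, whose distance from \<open>t\<close> is
  \<open>1 - norm t\<close>.\<close>

lemma tendsto_0_disc_boundary: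
  fixes k :: "complex \<Rightarrow> 'a::real_normed_vector"
  assumes "r < 1" and cont: "continuous_on {t. r \<le> norm t \<and> norm t \<le> 1} k"
    and zero: "\<And>t. norm t = 1 \<Longrightarrow> k t = 0"
  shows "(k \<longlongrightarrow> 0) disc_boundary"
proof (rule tendstoI)
  fix e :: real assume "e > 0"
  let ?A = "{t::complex. r \<le> norm t \<and> norm t \<le> 1}"
  have "?A = cball 0 1 - ball 0 r" by auto
  then have "compact ?A"
    by (simp only: compact_diff compact_cball open_ball)
  then have "uniformly_continuous_on ?A k"
    using compact_uniformly_continuous cont by blast
  then obtain d where d: "d > 0" "\<And>t t'. t \<in> ?A \<Longrightarrow> t' \<in> ?A \<Longrightarrow> dist t' t < d \<Longrightarrow> dist (k t') (k t) < e"
    unfolding uniformly_continuous_on_def using \<open>e > 0\<close> by blast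
  \<comment> \<open>The bound 0 keeps \<open>t\<close> away from the origin, so that
    \<open>sgn t\<close> really lies on the circle.\<close>
  have "max (max r (1 - d)) 0 < 1" using \<open>r < 1\<close> d(1) by simp
  from eventually_disc_boundary_norm[OF this] show "eventually (\<lambda>t. dist (k t) 0 < e) disc_boundary"
  proof eventually_elim
    case (elim t)
    then have t: "r < norm t" "1 - d < norm t" "0 < norm t" "norm t < 1" by auto
    have "t - sgn t = of_real (norm t - 1) * sgn t"
      using t(3) by (simp add: sgn_eq field_simps)
    then have "dist t (sgn t) = 1 - norm t"
      using t(3,4) unfolding dist_norm
      by (simp add: norm_mult norm_sgn flip: of_real_diff)
    moreover have "norm (sgn t) = 1" using t(3) by (simp add: norm_sgn)
    ultimately show ?case
      using d(2)[of "sgn t" t] zero[of "sgn t"] t \<open>r < 1\<close> by (auto simp: dist_norm)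
  qed
qed

text \<open>The maximum modulus principle is applied on a disc that contains \<open>z\<close> and
  whose radius is so close to 1 that \<open>norm (v t) < L + e\<close> on its boundary
  circle.\<close>

lemma holomorphic_norm_le_disc_boundary_limit:
  assumes hol: "v holomorphic_on ball 0 1"
    and lim: "((\<lambda>t. norm (v t)) \<longlongrightarrow> L) disc_boundary"
    and z: "z \<in> ball 0 1"
  shows "norm (v z) \<le> L"
proof (rule field_le_epsilon)
  fix e :: real assume "e > 0"
  then have "eventually (\<lambda>t. norm (v t) < L + e) disc_boundary"
    using order_tendstoD(2)[OF lim, of "L + e"] by simp
  then obtain \<delta> where \<delta>: "\<delta> < 1" "\<And>t. \<delta> < norm t \<Longrightarrow> norm t < 1 \<Longrightarrow> norm (v t) < L + e"
    unfolding eventually_disc_boundary by blast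
  have "max \<delta> (norm z) < 1" using z \<delta>(1) by simp
  then obtain r where r: "max \<delta> (norm z) < r" "r < 1" using dense by blast
  have "0 < r" using r(1) norm_ge_zero[of z] by linarith
  show "norm (v z) \<le> L + e"
  proof (rule maximum_modulus_frontier[of v "cball 0 r"])
    show "v holomorphic_on interior (cball 0 r)"
      by (rule holomorphic_on_subset[OF hol]) (use r in auto)
    have "continuous_on (cball 0 r) v"
      by (rule holomorphic_on_imp_continuous_on, rule holomorphic_on_subset[OF hol]) (use r in auto)
    then show "continuous_on (closure (cball 0 r)) v" by simp
    fix t assume "t \<in> frontier (cball (0::complex) r)"
    then have "norm t = r" using \<open>0 < r\<close> by simp
    then show "norm (v t) \<le> L + e" using \<delta>(2)[of t] r by simp
  qed (use r in auto)
qed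

text \<open>The preceding bound holds both for \<open>v\<close> and for its reciprocal, so the
  modulus equals \<open>L\<close> throughout the disc; it is then attained at the interior point
  0.\<close>

lemma holomorphic_const_norm_disc_boundary:
  assumes hol: "v holomorphic_on ball 0 1"
    and nz: "\<And>t. t \<in> ball 0 1 \<Longrightarrow> v t \<noteq> 0"
    and lim: "((\<lambda>t. norm (v t)) \<longlongrightarrow> L) disc_boundary" and "L > 0"
  shows "v constant_on ball 0 1" "\<And>t. t \<in> ball 0 1 \<Longrightarrow> norm (v t) = L"
proof -
  have 1: "norm (v t) \<le> L" if "t \<in> ball 0 1" for t
    by (rule holomorphic_norm_le_disc_boundary_limit[OF hol lim that])
  have 2: "norm (inverse (v t)) \<le> inverse L" if "t \<in> ball 0 1" for t
  proof (rule holomorphic_norm_le_disc_boundary_limit[OF _ _ that])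
    show "(\<lambda>t. inverse (v t)) holomorphic_on ball 0 1"
      by (intro holomorphic_intros hol nz)
    show "((\<lambda>t. norm (inverse (v t))) \<longlongrightarrow> inverse L) disc_boundary"
      unfolding norm_inverse using \<open>L > 0\<close> by (intro tendsto_intros lim) auto
  qed
  show eq: "norm (v t) = L" if "t \<in> ball 0 1" for t
  proof (rule antisym[OF 1[OF that]])
    show "L \<le> norm (v t)"
      using 2[OF that] nz[OF that] \<open>L > 0\<close> by (simp add: norm_inverse)
  qed
  show "v constant_on ball 0 1"
  proof (rule maximum_modulus_principle[OF hol])
    show "norm (v t) \<le> norm (v 0)" if "t \<in> ball 0 1" for t
      using eq[OF that] eq[of 0] by simp
  qed auto
qed

text \<open>The zero-free function \<open>exp (\<i> * u t)\<close> has modulus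
  \<open>exp (- Im (u t))\<close>, which tends to 1 at the circle, so the preceding lemma makes it
  constant of modulus 1.\<close>

lemma holomorphic_const_Im_disc_boundary:
  assumes hol: "u holomorphic_on ball 0 1"
    and lim: "((\<lambda>t. Im (u t)) \<longlongrightarrow> 0) disc_boundary"
  obtains B :: real where "\<And>t. t \<in> ball 0 1 \<Longrightarrow> u t = of_real B"
proof -
  define v where "v t = exp (\<i> * u t)" for t
  have hv: "v holomorphic_on ball 0 1"
    unfolding v_def by (intro holomorphic_intros hol)
  have nv: "norm (v t) = exp (- Im (u t))" for t
    by (simp add: v_def)
  have "((\<lambda>t. exp (- Im (u t))) \<longlongrightarrow> exp (- 0)) disc_boundary"
    by (intro tendsto_intros lim)
  then have lv: "((\<lambda>t. norm (v t)) \<longlongrightarrow> 1) disc_boundary"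
    by (simp add: nv)
  have vnz: "v t \<noteq> 0" for t by (simp add: v_def)
  note vc = holomorphic_const_norm_disc_boundary[OF hv vnz lv zero_less_one]
  have Im0: "Im (u t) = 0" if "t \<in> ball 0 1" for t
    using vc(2)[OF that] by (simp add: nv)
  obtain c where c: "\<And>t. t \<in> ball 0 1 \<Longrightarrow> v t = c"
    using vc(1) unfolding constant_on_def by blast
  \<comment> \<open>Constancy passes from the exponential to \<open>u\<close> through the
    derivative, which avoids the ambiguity of the logarithm.\<close>
  have "u constant_on ball 0 1"
  proof (rule has_field_derivative_0_imp_constant_on)
    fix t :: complex assume t: "t \<in> ball 0 1"
    have du: "(u has_field_derivative deriv u t) (at t)"
      using hol holomorphic_derivI open_ball t by blast
    have "(v has_field_derivative exp (\<i> * u t) * (\<i> * deriv u t)) (at t)"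
      unfolding v_def by (rule derivative_eq_intros du refl | simp)+
    moreover have "(v has_field_derivative 0) (at t)"
      by (rule has_field_derivative_transform_within_open[where f = "\<lambda>_. c" and S = "ball 0 1"])
        (use c t in auto)
    ultimately have "deriv u t = 0"
      using DERIV_unique by fastforce
    then show "(u has_field_derivative 0) (at t)" using du by simp
  qed auto
  then obtain b where "\<And>t. t \<in> ball 0 1 \<Longrightarrow> u t = b"
    unfolding constant_on_def by blast
  moreover have "b = of_real (Re b)"
    using Im0[of 0] calculation[of 0] by (simp add: complex_eq_iff)
  ultimately show ?thesis using that[of "Re b"] by simp
qed

text \<open>Properness of the conformal map: if \<open>norm (t n)\<close> tends to 1, a limit point
  of \<open>\<phi> (t n)\<close> cannot lie in \<Omega>, because continuity of the inverse
  \<open>f\<close> there would give it a value of modulus 1. A counterexample to the limit thus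
  produces a sequence converging to the frontier.\<close>

lemma tendsto_disc_boundaryI:
  fixes Q :: "complex \<Rightarrow> 'a::real_normed_vector"
  assumes \<Omega>: "open \<Omega>" "bounded \<Omega>" and f: "continuous_on \<Omega> f" "f ` \<Omega> \<subseteq> ball 0 1"
    and \<phi>: "\<phi> ` ball 0 1 \<subseteq> \<Omega>" "\<And>t. t \<in> ball 0 1 \<Longrightarrow> f (\<phi> t) = t"
    and Q: "\<And>w \<zeta>. \<lbrakk>\<zeta> \<in> frontier \<Omega>; \<And>n. w n \<in> \<Omega>; w \<longlonglongrightarrow> \<zeta>\<rbrakk> \<Longrightarrow> (\<lambda>n. Q (w n)) \<longlonglongrightarrow> 0"
  shows "((\<lambda>t. Q (\<phi> t)) \<longlongrightarrow> 0) disc_boundary"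
proof (rule tendstoI, rule ccontr)
  fix e :: real
  assume "e > 0" and neg: "\<not> eventually (\<lambda>t. dist (Q (\<phi> t)) 0 < e) disc_boundary"
  have "\<exists>t. 1 - inverse (real (Suc n)) < norm t \<and> norm t < 1 \<and> \<not> dist (Q (\<phi> t)) 0 < e" for n
  proof -
    have "1 - inverse (real (Suc n)) < 1" by simp
    then show ?thesis using neg unfolding eventually_disc_boundary by blast
  qed
  then have "\<exists>t. \<forall>n. 1 - inverse (real (Suc n)) < norm (t n) \<and> norm (t n) < 1 \<and> \<not> dist (Q (\<phi> (t n))) 0 < e"
    by (intro choice allI)
  then obtain t where tn: "\<forall>n. 1 - inverse (real (Suc n)) < norm (t n) \<and> norm (t n) < 1 \<and> \<not> dist (Q (\<phi> (t n))) 0 < e" ..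
  have t: "1 - inverse (real (Suc n)) < norm (t n)" "norm (t n) < 1"
      "\<not> dist (Q (\<phi> (t n))) 0 < e" for n
    using tn by blast+
  have t1: "(\<lambda>n. norm (t n)) \<longlonglongrightarrow> 1"
  proof (rule tendsto_sandwich[OF _ _ _ tendsto_const])
    show "(\<lambda>n. 1 - inverse (real (Suc n))) \<longlonglongrightarrow> 1"
      using tendsto_diff[OF tendsto_const LIMSEQ_inverse_real_of_nat, of 1] by simp
  qed (use t(1,2) in \<open>auto intro!: always_eventually less_imp_le\<close>)
  have tb: "t n \<in> ball 0 1" for n using t(2) by simp
  have \<phi>t: "\<phi> (t n) \<in> \<Omega>" for n using \<phi>(1) tb by blast
  have "seq_compact (closure \<Omega>)"
    using \<Omega>(2) by (simp add: compact_imp_seq_compact)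
  moreover have "\<forall>n. \<phi> (t n) \<in> closure \<Omega>" using \<phi>t closure_subset by blast
  ultimately obtain l r where l: "l \<in> closure \<Omega>" "strict_mono (r :: nat \<Rightarrow> nat)"
      and lim: "((\<lambda>n. \<phi> (t n)) \<circ> r) \<longlonglongrightarrow> l"
    by (rule seq_compactE)
  have lim: "(\<lambda>n. \<phi> (t (r n))) \<longlonglongrightarrow> l" using lim by (simp add: o_def)
  have l1: "(\<lambda>n. norm (t (r n))) \<longlonglongrightarrow> 1"
    using LIMSEQ_subseq_LIMSEQ[OF t1 l(2)] by (simp add: o_def)
  have "l \<notin> \<Omega>"
  proof
    assume "l \<in> \<Omega>"
    then have "(\<lambda>n. f (\<phi> (t (r n)))) \<longlonglongrightarrow> f l"
      using continuous_on_tendsto_compose[OF f(1) lim] \<phi>t by simp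
    then have "(\<lambda>n. t (r n)) \<longlonglongrightarrow> f l"
      using \<phi>(2) tb by simp
    then have "norm (f l) = 1"
      using LIMSEQ_unique[OF tendsto_norm l1] by blast
    then show False using f(2) \<open>l \<in> \<Omega>\<close> by auto
  qed
  then have "l \<in> frontier \<Omega>"
    using l(1) \<Omega>(1) by (simp add: frontier_def interior_open)
  then have "(\<lambda>n. Q (\<phi> (t (r n)))) \<longlonglongrightarrow> 0"
    using lim \<phi>t by (intro Q)
  from tendstoD[OF this \<open>e > 0\<close>] have "eventually (\<lambda>n. False) sequentially"
    by eventually_elim (use t(3) in simp)
  then show False by simp
qed

section \<open>Difference quotients and factorisation on the circle\<close>

text \<open>The difference quotient has a removable singularity at \<open>a\<close>. The
  factorisation holds for every \<open>z\<close>, also outside \<open>S\<close>, so it can later be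
  read as an equality of total functions.\<close>

lemma holomorphic_factor_diff:
  assumes "f holomorphic_on S" "open S" "a \<in> S"
  obtains q where "q holomorphic_on S" "\<And>z. f z = f a + (z - a) * q z" "q a = deriv f a"
proof
  let ?q = "\<lambda>z. if z = a then deriv f a else (f z - f a) / (z - a)"
  show "?q holomorphic_on S"
    using assms by (intro pole_lemma) (simp_all add: interior_open)
qed auto

text \<open>Blaschke factors are unimodular on the circle: multiply \<open>t - \<zeta>\<close> by
  the unimodular number \<open>cnj t\<close>, then conjugate.\<close>

lemma norm_diff_eq_norm_1_minus:
  assumes "norm (t::complex) = 1"
  shows "norm (t - \<zeta>) = norm (1 - cnj \<zeta> * t)"
proof -
  have "t * cnj t = 1" using assms by (simp add: complex_norm_square[symmetric])
  then have "cnj t * (t - \<zeta>) = 1 - cnj t * \<zeta>" by (simp add: algebra_simps)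
  then have "norm (t - \<zeta>) = norm (1 - cnj t * \<zeta>)"
    using assms norm_mult[of "cnj t" "t - \<zeta>"] by simp
  also have "\<dots> = norm (cnj (1 - cnj t * \<zeta>))" by (simp only: complex_mod_cnj)
  finally show ?thesis by (simp add: mult.commute)
qed

lemma one_minus_cnj_mult_nonzero:
  assumes "norm \<zeta> < 1" "norm t \<le> 1"
  shows "1 - cnj \<zeta> * t \<noteq> 0"
proof
  assume "1 - cnj \<zeta> * t = 0"
  then have "norm \<zeta> * norm t = 1" by (metis complex_mod_cnj eq_iff_diff_eq_0 norm_mult norm_one)
  moreover have "norm \<zeta> * norm t \<le> norm \<zeta> * 1"
    using assms by (intro mult_left_mono) auto
  ultimately show False using assms by simp
qed

text \<open>The Fejer--Riesz theorem in degree one; \<open>C\<close> is the larger root of \<open>C\<^sup>2 - \<beta> C + |\<alpha>|\<^sup>2\<close>.\<close>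

lemma positive_trigonometric_polynomial_factor:
  fixes \<alpha> :: complex and \<beta> :: real
  assumes pos: "\<And>\<tau>. norm \<tau> = 1 \<Longrightarrow> 0 < \<beta> + 2 * Re (cnj \<alpha> * \<tau>)"
  obtains C \<zeta> where "C > 0" "norm \<zeta> < 1"
    "\<And>\<tau>. norm \<tau> = 1 \<Longrightarrow> \<beta> + 2 * Re (cnj \<alpha> * \<tau>) = C * (norm (1 - cnj \<zeta> * \<tau>))\<^sup>2"
proof -
  have \<beta>: "2 * norm \<alpha> < \<beta>"
  proof (cases "\<alpha> = 0")
    case True
    then show ?thesis using pos[of 1] by simp
  next
    case False
    \<comment> \<open>At \<open>- sgn \<alpha>\<close> the trigonometric polynomial takes its
      minimum on the circle, namely \<open>\<beta> - 2 * norm \<alpha>\<close>.\<close>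
    have "cnj \<alpha> * (- sgn \<alpha>) = - of_real (norm \<alpha>)"
      using False by (simp add: sgn_eq complex_norm_square[symmetric] mult.commute[of "cnj \<alpha>"] power2_eq_square)
    then show ?thesis using pos[of "- sgn \<alpha>"] False by (simp add: norm_sgn)
  qed
  define D where "D = sqrt (\<beta>\<^sup>2 - 4 * (norm \<alpha>)\<^sup>2)"
  define C where "C = (\<beta> + D) / 2"
  have "(2 * norm \<alpha>)\<^sup>2 \<le> \<beta>\<^sup>2" using \<beta> by (intro power_mono) auto
  then have D: "D\<^sup>2 = \<beta>\<^sup>2 - 4 * (norm \<alpha>)\<^sup>2" "D \<ge> 0"
    by (simp_all add: D_def power_mult_distrib)
  have C: "C > norm \<alpha>" using \<beta> D(2) by (simp add: C_def)
  then have "C > 0" using norm_ge_zero[of \<alpha>] by linarith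
  have C2: "C\<^sup>2 + (norm \<alpha>)\<^sup>2 = \<beta> * C"
    using D(1) by (simp add: C_def power2_eq_square field_simps)
  \<comment> \<open>This choice matches the linear coefficient of the expanded square; the constant
    coefficient then agrees by the quadratic equation \<open>C2\<close>, and
    \<open>C > norm \<alpha>\<close> puts \<open>\<zeta>\<close> in the disc.\<close>
  define \<zeta> where "\<zeta> = - \<alpha> / of_real C"
  have "norm \<zeta> < 1"
    using C \<open>C > 0\<close> by (simp add: \<zeta>_def norm_divide)
  moreover have "\<beta> + 2 * Re (cnj \<alpha> * \<tau>) = C * (norm (1 - cnj \<zeta> * \<tau>))\<^sup>2" if "norm \<tau> = 1" for \<tau>
  proof -
    have "(norm (1 - cnj \<zeta> * \<tau>))\<^sup>2 = 1 - 2 * Re (cnj \<zeta> * \<tau>) + (norm (cnj \<zeta> * \<tau>))\<^sup>2"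
      unfolding cmod_power2 by (simp add: power2_eq_square algebra_simps)
    also have "norm (cnj \<zeta> * \<tau>) = norm \<alpha> / C"
      using that \<open>C > 0\<close> by (simp add: \<zeta>_def norm_mult norm_divide)
    also have "Re (cnj \<zeta> * \<tau>) = - Re (cnj \<alpha> * \<tau>) / C"
      using \<open>C > 0\<close> by (simp add: \<zeta>_def field_simps)
    finally have "C * (norm (1 - cnj \<zeta> * \<tau>))\<^sup>2 = (C\<^sup>2 + (norm \<alpha>)\<^sup>2) / C + 2 * Re (cnj \<alpha> * \<tau>)"
      using \<open>C > 0\<close> by (simp add: field_simps power2_eq_square)
    then show ?thesis using \<open>C > 0\<close> by (simp add: C2)
  qed
  ultimately show ?thesis using that \<open>C > 0\<close> by blast
qed

section \<open>Explicit form of the Riemann map\<close>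

text \<open>The problem transported to the disc: \<open>G\<close> is the regular part and
  \<open>K / (\<phi> t - \<phi> \<zeta>0)\<close> the polar part of a function asymptotic to the
  weight at the circle. Being asymptotically real determines this function, and comparing moduli
  then determines \<phi>.\<close>

lemma conformal_map_root_form:
  fixes \<phi> G :: "complex \<Rightarrow> complex" and K :: complex
  assumes \<phi>: "\<phi> holomorphic_on ball 0 1" "inj_on \<phi> (ball 0 1)" "\<phi> 0 = 0" "bounded (\<phi> ` ball 0 1)"
    and \<zeta>0: "\<zeta>0 \<in> ball 0 1" and G: "G holomorphic_on ball 0 1"
    and lim: "((\<lambda>t. G t + K / (\<phi> t - \<phi> \<zeta>0) - 1 / of_real (norm (\<phi> t) ^ (2 * p))) \<longlongrightarrow> 0) disc_boundary"
  obtains \<kappa> \<zeta>1 r where "\<kappa> \<noteq> 0" "norm \<zeta>1 < 1" "r holomorphic_on ball 0 1"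
    "\<And>t. t \<in> ball 0 1 \<Longrightarrow> r t ^ p = \<kappa> * (1 - cnj \<zeta>0 * t) / (1 - cnj \<zeta>1 * t)"
    "\<And>t. \<phi> t = t * r t"
proof -
  define h where "h t = G t + K / (\<phi> t - \<phi> \<zeta>0)" for t
  have \<zeta>n: "norm \<zeta>0 < 1" using \<zeta>0 by simp
  note nz0 = one_minus_cnj_mult_nonzero[OF \<zeta>n]

  obtain q where q: "q holomorphic_on ball 0 1" "\<And>t. \<phi> t = \<phi> \<zeta>0 + (t - \<zeta>0) * q t" "q \<zeta>0 = deriv \<phi> \<zeta>0"
    using holomorphic_factor_diff[OF \<phi>(1) open_ball \<zeta>0] by blast
  \<comment> \<open>Injectivity excludes zeros away from \<open>\<zeta>0\<close>, and the
    nonvanishing derivative excludes one at \<open>\<zeta>0\<close>. Hence \<open>1 / q\<close> is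
    holomorphic, and expanding it at \<open>\<zeta>0\<close> splits the polar term into
    \<open>A / (t - \<zeta>0)\<close> and the holomorphic \<open>K * m t\<close>.\<close>
  have qnz: "q t \<noteq> 0" if "t \<in> ball 0 1" for t
  proof (cases "t = \<zeta>0")
    case True
    then show ?thesis using holomorphic_injective_imp_regular[OF \<phi>(1) open_ball \<phi>(2) \<zeta>0] q(3) by simp
  next
    case False
    then have "\<phi> t \<noteq> \<phi> \<zeta>0" using \<phi>(2) that \<zeta>0 by (auto dest: inj_onD)
    then show ?thesis using q(2)[of t] by auto
  qed
  have "(\<lambda>t. inverse (q t)) holomorphic_on ball 0 1"
    by (intro holomorphic_intros q qnz)
  from holomorphic_factor_diff[OF this open_ball \<zeta>0]
  obtain m where m: "m holomorphic_on ball 0 1" "\<And>t. inverse (q t) = inverse (q \<zeta>0) + (t - \<zeta>0) * m t"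
    by blast
  define A where "A = K * inverse (q \<zeta>0)"
  text \<open>On the circle the second summand is the complex conjugate of the principal part \<open>A / (t - \<zeta>0)\<close>.\<close>
  define R where "R t = A / (t - \<zeta>0) + cnj A * t / (1 - cnj \<zeta>0 * t)" for t
  \<comment> \<open>The remainder of \<open>h\<close> after subtracting \<open>R\<close>: the pole
    at \<open>\<zeta>0\<close> cancels, and the reflected summand has no pole in the closed
    disc.\<close>
  define u where "u t = G t + K * m t - cnj A * t / (1 - cnj \<zeta>0 * t)" for t
  have u: "u holomorphic_on ball 0 1"
    unfolding u_def by (intro holomorphic_intros G m(1)) (use nz0 in auto)
  have hu: "h t = u t + R t" if "t \<noteq> \<zeta>0" for t
  proof -
    have "K / (\<phi> t - \<phi> \<zeta>0) = K * inverse (q t) / (t - \<zeta>0)"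
      using q(2)[of t] by (simp add: divide_inverse)
    also have "\<dots> = A / (t - \<zeta>0) + K * m t"
      unfolding m(2)[of t] A_def using that by (simp add: distrib_left add_divide_distrib)
    finally show ?thesis by (simp add: h_def u_def R_def)
  qed
  have ev\<zeta>: "eventually (\<lambda>t. t \<noteq> \<zeta>0) disc_boundary"
    using eventually_disc_boundary_norm[OF \<zeta>n] by eventually_elim auto

  obtain \<rho> where \<rho>: "norm \<zeta>0 < \<rho>" "\<rho> < 1" using dense[OF \<zeta>n] by blast
  let ?A = "{t::complex. \<rho> \<le> norm t \<and> norm t \<le> 1}"
  have cR: "continuous_on ?A R"
    unfolding R_def by (intro continuous_intros) (use nz0 \<rho> in auto)
  \<comment> \<open>\<open>\<alpha> B\<close> and \<open>\<beta> B\<close> are the coefficients of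
    the numerator when \<open>of_real B + R \<tau>\<close> is put over the common denominator
    \<open>(\<tau> - \<zeta>0) * cnj (\<tau> - \<zeta>0)\<close> on the circle.\<close>
  define \<alpha> where "\<alpha> B = A - of_real B * \<zeta>0" for B :: real
  define \<beta> where "\<beta> B = B * (1 + (norm \<zeta>0)\<^sup>2) - 2 * Re (A * cnj \<zeta>0)" for B
  define W where "W B t = (\<beta> B + 2 * Re (cnj (\<alpha> B) * t)) / (norm (1 - cnj \<zeta>0 * t))\<^sup>2" for B t
  have RW: "of_real B + R \<tau> = of_real (W B \<tau>)" if \<tau>: "norm \<tau> = 1" for B \<tau>
  proof -
    have \<tau>c: "\<tau> * cnj \<tau> = 1" using \<tau> by (simp add: complex_norm_square[symmetric])
    have "\<tau> \<noteq> \<zeta>0" using \<tau> \<zeta>n by auto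
    then have e: "cnj (\<tau> - \<zeta>0) \<noteq> 0" "\<tau> - \<zeta>0 \<noteq> 0" by (simp_all only: complex_cnj_zero_iff right_minus_eq not_False_eq_True)
    have s: "1 - cnj \<zeta>0 * \<tau> = \<tau> * cnj (\<tau> - \<zeta>0)"
      using \<tau>c by (simp add: algebra_simps)
    have n: "of_real ((norm (1 - cnj \<zeta>0 * \<tau>))\<^sup>2) = (\<tau> - \<zeta>0) * cnj (\<tau> - \<zeta>0)"
      unfolding norm_diff_eq_norm_1_minus[OF \<tau>, symmetric] complex_norm_square ..
    have "\<tau> \<noteq> 0" using \<tau> by auto
    have "R \<tau> = A / (\<tau> - \<zeta>0) + cnj A / cnj (\<tau> - \<zeta>0)"
      unfolding R_def s using \<open>\<tau> \<noteq> 0\<close> by simp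
    moreover have "(b + (k / x + l / y)) * (x * y) = b * (x * y) + k * y + l * x"
      if "x \<noteq> 0" "y \<noteq> 0" for b k l x y :: complex
      using that by (simp add: field_simps)
    ultimately have "(of_real B + R \<tau>) * ((\<tau> - \<zeta>0) * cnj (\<tau> - \<zeta>0)) =
        of_real B * ((\<tau> - \<zeta>0) * cnj (\<tau> - \<zeta>0)) + A * cnj (\<tau> - \<zeta>0) + cnj A * (\<tau> - \<zeta>0)"
      using e by (simp only: not_False_eq_True)
    also have "\<dots> = of_real B * (\<tau> * cnj \<tau> + \<zeta>0 * cnj \<zeta>0) - (A * cnj \<zeta>0 + cnj (A * cnj \<zeta>0))
        + (cnj (\<alpha> B) * \<tau> + cnj (cnj (\<alpha> B) * \<tau>))"
      unfolding \<alpha>_def by (simp add: algebra_simps)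
    also have "\<dots> = of_real (\<beta> B + 2 * Re (cnj (\<alpha> B) * \<tau>))"
      unfolding complex_add_cnj \<beta>_def complex_norm_square[symmetric] by (simp add: \<tau>)
    finally show ?thesis
      unfolding W_def of_real_divide n using e by (simp add: eq_divide_eq del: complex_cnj_diff)
  qed

  have "((\<lambda>t. Im (R t)) \<longlongrightarrow> 0) disc_boundary"
  proof (rule tendsto_0_disc_boundary[OF \<rho>(2)])
    show "continuous_on ?A (\<lambda>t. Im (R t))" by (intro continuous_intros cR)
    show "Im (R t) = 0" if "norm t = 1" for t using RW[OF that, of 0] by simp
  qed
  moreover have "((\<lambda>t. Im (h t)) \<longlongrightarrow> 0) disc_boundary"
  proof -
    have "((\<lambda>t. Im (h t - 1 / of_real (norm (\<phi> t) ^ (2 * p)))) \<longlongrightarrow> Im 0) disc_boundary"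
      unfolding h_def by (intro tendsto_intros lim)
    moreover have "Im (1 / of_real x) = 0" for x
      by (metis Im_complex_of_real of_real_1 of_real_divide)
    ultimately show ?thesis by (simp only: minus_complex.sel zero_complex.sel diff_zero)
  qed
  ultimately have "((\<lambda>t. Im (h t) - Im (R t)) \<longlongrightarrow> 0 - 0) disc_boundary"
    by (intro tendsto_diff)
  then have "((\<lambda>t. Im (u t)) \<longlongrightarrow> 0) disc_boundary"
    unfolding diff_zero
  proof (rule Lim_transform_eventually)
    show "eventually (\<lambda>t. Im (h t) - Im (R t) = Im (u t)) disc_boundary"
      using ev\<zeta> by eventually_elim (simp add: hu)
  qed
  from holomorphic_const_Im_disc_boundary[OF u this]
  obtain B where B: "\<And>t. t \<in> ball 0 1 \<Longrightarrow> u t = of_real B" by blast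

  have cW: "continuous_on ?A (W B)"
    unfolding W_def by (intro continuous_intros) (use nz0 in auto)
  \<comment> \<open>Both functions are continuous on the closed annulus and agree on the circle, so
    the real-valued \<open>W B\<close> may replace \<open>h\<close> in the limit.\<close>
  have "((\<lambda>t. of_real B + R t - of_real (W B t)) \<longlongrightarrow> 0) disc_boundary"
    by (rule tendsto_0_disc_boundary[OF \<rho>(2)])
      (auto intro!: continuous_intros cR cW simp: RW)
  from tendsto_diff[OF lim this]
  have "((\<lambda>t. of_real (W B t - 1 / norm (\<phi> t) ^ (2 * p)) :: complex) \<longlongrightarrow> 0) disc_boundary"
    unfolding diff_zero
  proof (rule Lim_transform_eventually)
    show "eventually (\<lambda>t. G t + K / (\<phi> t - \<phi> \<zeta>0) - 1 / of_real (norm (\<phi> t) ^ (2 * p))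
        - (of_real B + R t - of_real (W B t)) = of_real (W B t - 1 / norm (\<phi> t) ^ (2 * p))) disc_boundary"
      using ev\<zeta> eventually_disc_boundary_norm[OF \<zeta>n]
    proof eventually_elim
      case (elim t)
      then have "u t = of_real B" using B[of t] by simp
      then show ?case using hu[OF elim(1)] by (simp add: h_def)
    qed
  qed
  then have limW: "((\<lambda>t. W B t - 1 / norm (\<phi> t) ^ (2 * p)) \<longlongrightarrow> 0) disc_boundary"
    using tendsto_of_real_iff[where c = 0] by fastforce

  obtain M where M: "M > 0" "\<And>t. t \<in> ball 0 1 \<Longrightarrow> norm (\<phi> t) \<le> M"
    using \<phi>(4) unfolding bounded_pos by blast
  have \<phi>nz: "\<phi> t \<noteq> 0" if "0 < norm t" "norm t < 1" for t
    using inj_onD[OF \<phi>(2), of t 0] \<phi>(3) that by auto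
  \<comment> \<open>The weight is at least \<open>1 / M ^ (2 * p)\<close> because \<phi> is bounded
    by \<open>M\<close>; the radial limit carries this positive lower bound over to
    \<open>W B \<tau>\<close>.\<close>
  have Wpos: "0 < W B \<tau>" if \<tau>: "norm \<tau> = 1" for \<tau>
  proof -
    have "((\<lambda>r. W B (of_real r * \<tau>)) \<longlongrightarrow> W B (of_real 1 * \<tau>)) (at_left 1)"
      unfolding W_def by (intro tendsto_intros) (use nz0[of \<tau>] \<tau> in auto)
    moreover have "((\<lambda>r. W B (of_real r * \<tau>) - 1 / norm (\<phi> (of_real r * \<tau>)) ^ (2 * p)) \<longlongrightarrow> 0) (at_left 1)"
      using filterlim_compose[OF limW filterlim_disc_boundary_radial[OF \<tau>]] .
    ultimately have "((\<lambda>r. 1 / norm (\<phi> (of_real r * \<tau>)) ^ (2 * p)) \<longlongrightarrow> W B \<tau>) (at_left 1)"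
      using tendsto_diff by fastforce
    moreover have "eventually (\<lambda>r. 1 / M ^ (2 * p) \<le> 1 / norm (\<phi> (of_real r * \<tau>)) ^ (2 * p)) (at_left 1)"
    proof -
      have "eventually (\<lambda>r. r \<in> {0<..<1::real}) (at_left 1)"
        by (rule eventually_at_leftI[of 0]) auto
      then show ?thesis
      proof eventually_elim
        case (elim r)
        then have "norm (of_real r * \<tau>) = r" using \<tau> by (simp add: norm_mult)
        with elim show ?case
          using M(2)[of "of_real r * \<tau>"] \<phi>nz[of "of_real r * \<tau>"]
          by (intro divide_left_mono power_mono mult_pos_pos zero_less_power) (use M(1) in auto)
      qed
    qed
    ultimately have "1 / M ^ (2 * p) \<le> W B \<tau>"
      by (intro tendsto_lowerbound[OF _ _ trivial_limit_at_left_real])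
    moreover have "0 < 1 / M ^ (2 * p)" using M(1) by simp
    ultimately show ?thesis by linarith
  qed
  have "0 < \<beta> B + 2 * Re (cnj (\<alpha> B) * \<tau>)" if \<tau>: "norm \<tau> = 1" for \<tau>
    using Wpos[OF \<tau>] nz0[of \<tau>] \<tau> by (simp add: W_def zero_less_divide_iff)
  then obtain C \<zeta>1 where C: "C > 0" and \<zeta>1: "norm \<zeta>1 < 1"
      and fac: "\<And>\<tau>. norm \<tau> = 1 \<Longrightarrow> \<beta> B + 2 * Re (cnj (\<alpha> B) * \<tau>) = C * (norm (1 - cnj \<zeta>1 * \<tau>))\<^sup>2"
    using positive_trigonometric_polynomial_factor[of "\<beta> B" "\<alpha> B"] by blast
  note nz1 = one_minus_cnj_mult_nonzero[OF \<zeta>1]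
  define V where "V t = C * (norm (1 - cnj \<zeta>1 * t))\<^sup>2 / (norm (1 - cnj \<zeta>0 * t))\<^sup>2" for t
  have "((\<lambda>t. W B t - V t) \<longlongrightarrow> 0) disc_boundary"
  proof (rule tendsto_0_disc_boundary[OF \<rho>(2)])
    show "continuous_on ?A (\<lambda>t. W B t - V t)"
      unfolding V_def by (intro continuous_intros cW) (use nz0 in auto)
    show "W B t - V t = 0" if "norm t = 1" for t
      using fac[OF that] by (simp add: V_def W_def)
  qed
  from tendsto_diff[OF limW this]
  have limV: "((\<lambda>t. V t - 1 / norm (\<phi> t) ^ (2 * p)) \<longlongrightarrow> 0) disc_boundary" by simp

  obtain r where r: "r holomorphic_on ball 0 1" "\<And>t. \<phi> t = \<phi> 0 + (t - 0) * r t" "r 0 = deriv \<phi> 0"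
    using holomorphic_factor_diff[OF \<phi>(1) open_ball, of 0] by auto
  have \<phi>r: "\<phi> t = t * r t" for t using r(2)[of t] \<phi>(3) by simp
  have rnz: "r t \<noteq> 0" if "t \<in> ball 0 1" for t
  proof (cases "t = 0")
    case True
    then show ?thesis using holomorphic_injective_imp_regular[OF \<phi>(1) open_ball \<phi>(2), of 0] r(3) by simp
  next
    case False
    then show ?thesis using \<phi>nz[of t] that \<phi>r[of t] by auto
  qed
  \<comment> \<open>Chosen so that the squared modulus of \<open>v t\<close> is
    \<open>norm (r t) ^ (2 * p) * (V t / C)\<close>. Since \<open>V t\<close> is asymptotic to the
    inverse of \<open>norm (\<phi> t) ^ (2 * p)\<close>, this tends to \<open>1 / C\<close>.\<close>
  define v where "v t = r t ^ p * (1 - cnj \<zeta>1 * t) / (1 - cnj \<zeta>0 * t)" for t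
  have hv: "v holomorphic_on ball 0 1"
    unfolding v_def by (intro holomorphic_intros r) (use nz0 in auto)
  have vnz: "v t \<noteq> 0" if "t \<in> ball 0 1" for t
    using rnz[OF that] nz0[of t] nz1[of t] that by (simp add: v_def)
  \<comment> \<open>Boundedness of \<phi> turns the vanishing difference into a vanishing relative
    error: \<open>norm (\<phi> t) ^ (2 * p) * V t\<close> tends to 1.\<close>
  have "((\<lambda>t. norm (\<phi> t) ^ (2 * p) * (V t - 1 / norm (\<phi> t) ^ (2 * p))) \<longlongrightarrow> 0) disc_boundary"
  proof (rule Lim_null_comparison)
    have "((\<lambda>t. M ^ (2 * p) * norm (V t - 1 / norm (\<phi> t) ^ (2 * p))) \<longlongrightarrow> M ^ (2 * p) * norm (0::real)) disc_boundary"
      by (intro tendsto_intros limV)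
    then show "((\<lambda>t. M ^ (2 * p) * norm (V t - 1 / norm (\<phi> t) ^ (2 * p))) \<longlongrightarrow> 0) disc_boundary"
      by simp
    show "eventually (\<lambda>t. norm (norm (\<phi> t) ^ (2 * p) * (V t - 1 / norm (\<phi> t) ^ (2 * p)))
        \<le> M ^ (2 * p) * norm (V t - 1 / norm (\<phi> t) ^ (2 * p))) disc_boundary"
      using eventually_disc_boundary_norm[OF zero_less_one]
    proof eventually_elim
      case (elim t)
      then have "norm (\<phi> t) ^ (2 * p) \<le> M ^ (2 * p)"
        using M(2)[of t] by (intro power_mono) auto
      then show ?case
        unfolding norm_mult by (intro mult_right_mono) (simp_all add: norm_power)
    qed
  qed
  moreover have "((\<lambda>t::complex. norm t ^ (2 * p)) \<longlongrightarrow> 1) disc_boundary"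
  proof -
    have "((\<lambda>t::complex. norm t ^ (2 * p) - 1) \<longlongrightarrow> 0) disc_boundary"
      by (rule tendsto_0_disc_boundary[of 0]) (auto intro!: continuous_intros)
    from tendsto_add[OF this tendsto_const[of 1]] show ?thesis by simp
  qed
  ultimately have "((\<lambda>t. sqrt ((1 + norm (\<phi> t) ^ (2 * p) * (V t - 1 / norm (\<phi> t) ^ (2 * p))) / (C * norm t ^ (2 * p))))
      \<longlongrightarrow> sqrt ((1 + 0) / (C * 1))) disc_boundary"
    using C by (intro tendsto_intros) auto
  then have "((\<lambda>t. norm (v t)) \<longlongrightarrow> sqrt (1 / C)) disc_boundary"
    unfolding add_0_right mult_1_right
  proof (rule Lim_transform_eventually)
    show "eventually (\<lambda>t. sqrt ((1 + norm (\<phi> t) ^ (2 * p) * (V t - 1 / norm (\<phi> t) ^ (2 * p))) / (C * norm t ^ (2 * p)))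
        = norm (v t)) disc_boundary"
      using eventually_disc_boundary_norm[OF zero_less_one]
    proof eventually_elim
      case (elim t)
      then have "\<phi> t \<noteq> 0" "t \<noteq> 0" using \<phi>nz by auto
      have "(1 + norm (\<phi> t) ^ (2 * p) * (V t - 1 / norm (\<phi> t) ^ (2 * p))) / (C * norm t ^ (2 * p))
          = norm (\<phi> t) ^ (2 * p) * V t / (C * norm t ^ (2 * p))"
        using \<open>\<phi> t \<noteq> 0\<close> by (simp add: right_diff_distrib)
      also have "\<dots> = norm (r t) ^ (2 * p) * (V t / C)"
        using \<open>t \<noteq> 0\<close> unfolding \<phi>r by (simp add: norm_mult power_mult_distrib)
      also have "\<dots> = (norm (v t))\<^sup>2"
        using C by (simp add: V_def v_def norm_mult norm_divide norm_power power_mult_distrib power_divide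
            power_mult[symmetric] mult.commute[of p])
      finally show ?case by simp
    qed
  qed
  moreover have "sqrt (1 / C) > 0" using C by simp
  ultimately obtain \<kappa> where \<kappa>: "\<And>t. t \<in> ball 0 1 \<Longrightarrow> v t = \<kappa>"
    using holomorphic_const_norm_disc_boundary(1)[OF hv vnz] unfolding constant_on_def by blast
  show ?thesis
  proof (rule that[OF _ \<zeta>1 r(1) _ \<phi>r])
    show "\<kappa> \<noteq> 0" using \<kappa>[of 0] vnz[of 0] by simp
    fix t :: complex assume t: "t \<in> ball 0 1"
    show "r t ^ p = \<kappa> * (1 - cnj \<zeta>0 * t) / (1 - cnj \<zeta>1 * t)"
      using nz0[of t] nz1[of t] t unfolding \<kappa>[OF t, symmetric] v_def by simp
  qed
qed

section \<open>The boundary curve, test functions and the normalised Riemann map\<close>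

text \<open>A bounded simply connected open set has connected frontier, which cannot be a union of
  two or more disjoint closed curves. A connected set that meets \<Omega> and misses the frontier
  lies in \<Omega>: for the outside this contradicts boundedness, for the inside it gives
  equality.\<close>

lemma simply_connected_smooth_bounded_domain_inside:
  assumes \<Omega>: "open \<Omega>" "connected \<Omega>" "\<Omega> \<noteq> {}" "bounded \<Omega>" "simply_connected \<Omega>"
    and \<Gamma>: "positive_boundary_param \<Omega> \<Gamma>"
  obtains \<gamma> where "\<Gamma> = {\<gamma>}" "smooth_Jordan_curve \<gamma>" "\<Omega> = inside (path_image \<gamma>)"
    "frontier \<Omega> = path_image \<gamma>"
proof -
  have fin: "finite \<Gamma>" and sm: "\<And>\<gamma>. \<gamma> \<in> \<Gamma> \<Longrightarrow> smooth_Jordan_curve \<gamma>"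
    and dis: "disjoint_family_on path_image \<Gamma>" and fr: "frontier \<Omega> = (\<Union>\<gamma>\<in>\<Gamma>. path_image \<gamma>)"
    using \<Gamma> unfolding positive_boundary_param_def by blast+
  have sp: "simple_path \<gamma>" if "\<gamma> \<in> \<Gamma>" for \<gamma>
    using smooth_Jordan_curveD(1)[OF sm[OF that]] .
  have closed: "closed (path_image \<gamma>)" if "\<gamma> \<in> \<Gamma>" for \<gamma>
    using sp[OF that] by (simp add: closed_simple_path_image)
  have conn: "connected (frontier \<Omega>)"
    using simply_connected_eq_frontier_properties[OF \<Omega>(1)] \<Omega>(4,5) by simp
  have "frontier \<Omega> \<noteq> {}"
    using \<Omega>(3,4) by (metis frontier_eq_empty not_bounded_UNIV)
  then obtain \<gamma> where \<gamma>: "\<gamma> \<in> \<Gamma>" using fr by blast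
  let ?B = "\<Union>\<delta>\<in>\<Gamma> - {\<gamma>}. path_image \<delta>"
  have "\<Gamma> - {\<gamma>} = {}"
  proof (rule ccontr)
    assume "\<Gamma> - {\<gamma>} \<noteq> {}"
    then have "?B \<noteq> {}" using path_image_nonempty by blast
    moreover have "closed ?B" using fin closed by (intro closed_UN) auto
    moreover have "frontier \<Omega> = path_image \<gamma> \<union> ?B" using fr \<gamma> by blast
    ultimately have "path_image \<gamma> \<inter> ?B \<noteq> {}"
      using connected_as_closed_union[OF conn _ closed[OF \<gamma>]] path_image_nonempty by blast
    then show False
      using dis \<gamma> unfolding disjoint_family_on_def by blast
  qed
  then have \<Gamma>\<gamma>: "\<Gamma> = {\<gamma>}" using \<gamma> by blast
  then have fr\<gamma>: "frontier \<Omega> = path_image \<gamma>" using fr by simp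
  let ?I = "inside (path_image \<gamma>)" and ?O = "outside (path_image \<gamma>)"
  note J = Jordan_inside_outside[OF smooth_Jordan_curveD(1,2)[OF sm[OF \<gamma>]]]
  have \<Omega>P: "\<Omega> \<inter> path_image \<gamma> = {}"
    using \<Omega>(1) fr\<gamma> frontier_disjoint_eq by blast
  have fill: "S \<subseteq> \<Omega>" if "connected S" "S \<inter> path_image \<gamma> = {}" "S \<inter> \<Omega> \<noteq> {}" for S
    using connected_Int_frontier[OF that(1,3)] that(2) fr\<gamma> by blast
  have "?O \<inter> \<Omega> = {}"
  proof (rule ccontr)
    assume "?O \<inter> \<Omega> \<noteq> {}"
    then have "?O \<subseteq> \<Omega>" using J by (intro fill) (auto simp: outside_no_overlap)
    then show False using J \<Omega>(4) bounded_subset by blast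
  qed
  then have sub: "\<Omega> \<subseteq> ?I" using \<Omega>P J by blast
  then have "?I \<subseteq> \<Omega>" using J \<Omega>(3) by (intro fill) (auto simp: inside_no_overlap)
  with sub have "\<Omega> = ?I" by blast
  then show ?thesis using that[OF \<Gamma>\<gamma> sm[OF \<gamma>] _ fr\<gamma>] by blast
qed

text \<open>Admits the Cauchy kernels with pole off the closure as test functions; the derivatives
  on \<open>U\<close> are their own continuous extensions.\<close>

lemma A_infinity_holomorphic_on_open:
  assumes "f holomorphic_on U" "open U" "closure \<Omega> \<subseteq> U"
  shows "f \<in> A_infinity \<Omega>"
  unfolding A_infinity_def
proof (intro CollectI conjI allI)
  have "\<Omega> \<subseteq> U" using assms(3) closure_subset by blast
  then show "f holomorphic_on \<Omega>" using assms(1) holomorphic_on_subset by blast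
  have *: "continuous_on (closure \<Omega>) ((deriv ^^ n) f)" for n
    using holomorphic_higher_deriv[OF assms(1,2)] assms(3)
      holomorphic_on_imp_continuous_on holomorphic_on_subset by blast
  from *[of 0] show "continuous_on (closure \<Omega>) f" by simp
  show "\<exists>F. continuous_on (closure \<Omega>) F \<and> (\<forall>z\<in>\<Omega>. F z = (deriv ^^ n) f z)" for n
    using *[of n] by blast
qed

text \<open>Differentiation under the integral sign, obtained from
  \<open>Cauchy_next_derivative\<close> with exponent 1; this is why the kernel in
  \<open>int\<close> carries a first power.\<close>

lemma Cauchy_transform_holomorphic:
  assumes C1: "\<gamma> C1_differentiable_on {0..1}" and g: "continuous_on (path_image \<gamma>) g"
    and S: "open S" "S \<inter> path_image \<gamma> = {}"
  shows "(\<lambda>w. contour_integral \<gamma> (\<lambda>z. g z / (z - w))) holomorphic_on S"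
  unfolding holomorphic_on_open[OF S(1)]
proof
  fix w assume w: "w \<in> S"
  note path = C1_differentiable_on_imp_path[OF C1]
  obtain B where B: "\<And>t. t \<in> {0..1} \<Longrightarrow> norm (vector_derivative \<gamma> (at t)) \<le> B"
    by (rule C1_differentiable_on_bounded_derivative[OF C1]) blast
  have int: "((\<lambda>z. g z / (z - v) ^ 1) has_contour_integral contour_integral \<gamma> (\<lambda>z. g z / (z - v))) \<gamma>"
    if "v \<in> S - path_image \<gamma>" for v
  proof -
    have "continuous_on {0..1} (\<lambda>t. g (\<gamma> t))"
      by (rule continuous_on_compose2[OF g path(2)]) (simp add: path_image_def)
    then have "(\<lambda>z. g z / (z - v)) contour_integrable_on \<gamma>"
      unfolding contour_integrable_on using that
      by (intro integrable_continuous_interval continuous_intros path) (auto simp: path_image_def)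
    then show ?thesis by (simp add: has_contour_integral_integral)
  qed
  have "w \<in> S - path_image \<gamma>" using w S(2) by blast
  from Cauchy_next_derivative(2)[OF g B int one_neq_zero S(1) path(1) this]
  show "\<exists>f'. ((\<lambda>w. contour_integral \<gamma> (\<lambda>z. g z / (z - w))) has_field_derivative f') (at w)"
    by blast
qed

text \<open>An arbitrary Riemann map is normalised by a disc automorphism \<open>m\<close>, with
  inverse \<open>n\<close>, that sends the image of \<open>a\<close> to 0.\<close>

lemma pointed_Riemann_map:
  assumes "open \<Omega>" "simply_connected \<Omega>" "\<Omega> \<noteq> UNIV" "a \<in> \<Omega>"
  obtains \<phi> \<psi> where "\<phi> holomorphic_on ball 0 1" "\<psi> holomorphic_on \<Omega>" "\<phi> 0 = a"
    "\<And>t. t \<in> ball 0 1 \<Longrightarrow> \<phi> t \<in> \<Omega> \<and> \<psi> (\<phi> t) = t"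
    "\<And>z. z \<in> \<Omega> \<Longrightarrow> \<psi> z \<in> ball 0 1 \<and> \<phi> (\<psi> z) = z"
proof -
  obtain f g where f: "f holomorphic_on \<Omega>" and g: "g holomorphic_on ball 0 1"
    and fg: "\<And>z. z \<in> \<Omega> \<Longrightarrow> f z \<in> ball 0 1 \<and> g (f z) = z"
    and gf: "\<And>z. z \<in> ball 0 1 \<Longrightarrow> g z \<in> \<Omega> \<and> f (g z) = z"
    using Riemann_mapping_theorem[of \<Omega>] assms by blast
  have "f a \<in> ball 0 1" using fg[OF assms(4)] by blast
  then obtain m n where m: "m (f a) = 0" "m holomorphic_on ball 0 1" "m ` ball 0 1 \<subseteq> ball 0 1"
    and n: "n holomorphic_on ball 0 1" "n ` ball 0 1 \<subseteq> ball 0 1"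
    and mn: "\<And>z. z \<in> ball 0 1 \<Longrightarrow> m (n z) = z" "\<And>z. z \<in> ball 0 1 \<Longrightarrow> n (m z) = z"
    by (rule ball_biholomorphism_exists) blast
  show ?thesis
  proof (rule that[of "g \<circ> n" "m \<circ> f"])
    show "g \<circ> n holomorphic_on ball 0 1"
      by (rule holomorphic_on_compose_gen[OF n(1) g n(2)])
    show "m \<circ> f holomorphic_on \<Omega>"
      by (rule holomorphic_on_compose_gen[OF f m(2)]) (use fg in blast)
    show "(g \<circ> n) 0 = a"
      using mn(2)[OF \<open>f a \<in> ball 0 1\<close>] m(1) fg[OF assms(4)] by simp
    show "(g \<circ> n) t \<in> \<Omega> \<and> (m \<circ> f) ((g \<circ> n) t) = t" if "t \<in> ball 0 1" for t
    proof -
      have "n t \<in> ball 0 1" using n(2) that by blast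
      then show ?thesis using gf[of "n t"] mn(1)[OF that] by simp
    qed
    show "(m \<circ> f) z \<in> ball 0 1 \<and> (g \<circ> n) ((m \<circ> f) z) = z" if "z \<in> \<Omega>" for z
    proof -
      have "f z \<in> ball 0 1" "g (f z) = z" using fg[OF that] by blast+
      moreover have "m (f z) \<in> ball 0 1" using m(3) calculation(1) by blast
      ultimately show ?thesis using mn(2)[of "f z"] by simp
    qed
  qed
qed

section \<open>From the quadrature identity to the conformal map\<close>

theorem theorem8:
  fixes p :: nat and \<Omega> :: "complex set" and z0 :: complex
  assumes "p \<ge> 1"
    and "smooth_bounded_domain \<Omega>"
    and "simply_connected \<Omega>"
    and "one_point_quadrature_domain p \<Omega> z0"
    and "0 \<in> \<Omega>"
    and "z0 \<noteq> 0"
  shows "(\<exists>a b \<zeta>0 r. norm a > norm b \<and> \<zeta>0 \<in> ball 0 1 \<and>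
            analytic_root_branch p (ball 0 1) (\<lambda>t. (a + b * t) / (1 - t * cnj \<zeta>0)) r \<and>
            conformal_map_onto (\<lambda>t. t * r t) (ball 0 1) \<Omega>)
       \<or> (\<exists>a b c \<zeta>0 r. (\<forall>t. a + b * t + c * t ^ 2 = 0 \<longrightarrow> norm t > 1) \<and> \<zeta>0 \<in> ball 0 1 \<and>
            analytic_root_branch p (ball 0 1) (\<lambda>t. (a + b * t + c * t ^ 2) / (1 - t * cnj \<zeta>0)) r \<and>
            conformal_map_onto (\<lambda>t. t * r t) (ball 0 1) \<Omega>)"
proof (rule disjI1)
  have \<Omega>: "open \<Omega>" "connected \<Omega>" "\<Omega> \<noteq> {}" "bounded \<Omega>"
    and ex\<Gamma>: "\<exists>\<Gamma>. positive_boundary_param \<Omega> \<Gamma>"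
    using assms(2) unfolding smooth_bounded_domain_def by blast+
  have z0: "z0 \<in> \<Omega>" using assms(4) by (simp add: one_point_quadrature_domain_def)
  obtain c0 where c0: "\<And>f. f \<in> A_infinity \<Omega> \<Longrightarrow>
      boundary_integral \<Omega> (\<lambda>z. f z / of_real (norm z ^ (2 * p))) = c0 * f z0"
    using assms(4) unfolding one_point_quadrature_domain_def by (elim conjE exE) blast
  \<comment> \<open>The lemma applies to whichever parametrisation the choice operator in
    \<open>boundary_integral\<close> returns, so the boundary integral becomes one contour
    integral.\<close>
  obtain \<gamma> where \<Gamma>: "(SOME \<Gamma>. positive_boundary_param \<Omega> \<Gamma>) = {\<gamma>}" and sm: "smooth_Jordan_curve \<gamma>"
    and in\<gamma>: "\<Omega> = inside (path_image \<gamma>)" and fr: "frontier \<Omega> = path_image \<gamma>"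
    by (rule simply_connected_smooth_bounded_domain_inside[OF \<Omega> assms(3) someI_ex[OF ex\<Gamma>]])
  note \<gamma> = smooth_Jordan_curveD[OF sm]
  note J = Jordan_inside_outside[OF \<gamma>(1,2)]
  have \<Omega>P: "\<Omega> \<inter> path_image \<gamma> = {}"
    unfolding in\<gamma> by (rule inside_no_overlap)
  define g where "g z = (1 / of_real (norm z ^ (2 * p)) :: complex)" for z :: complex
  define I where "I w = contour_integral \<gamma> (\<lambda>z. g z / (z - w))" for w

  have I_out: "I w = c0 / (z0 - w)" if "w \<in> outside (path_image \<gamma>)" for w
  proof -
    have "w \<notin> closure \<Omega>"
      using that J fr outside_no_overlap[of "path_image \<gamma>"]
      unfolding closure_Un_frontier in\<gamma>[symmetric] by blast
    then have "(\<lambda>z. 1 / (z - w)) \<in> A_infinity \<Omega>"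
      by (intro A_infinity_holomorphic_on_open[of _ "- {w}"] holomorphic_intros) auto
    from c0[OF this] show ?thesis
      by (simp add: boundary_integral_def \<Gamma> I_def g_def mult.commute)
  qed
  have "0 \<notin> path_image \<gamma>" using \<Omega>P assms(5) by blast
  then obtain L where lip: "L-lipschitz_on (path_image \<gamma>) g"
    using lipschitz_on_inverse_norm_power[of "path_image \<gamma>" "2 * p"] \<gamma>(1)
    unfolding g_def by (auto simp: compact_simple_path_image)
  have cg: "continuous_on (path_image \<gamma>) g"
    using lip lipschitz_on_continuous_on by blast
  \<comment> \<open>The winding number inside is 1 or -1; either sign makes the jump factor
    \<open>k\<close> nonzero.\<close>
  obtain s where s: "s \<noteq> 0" "\<And>z. z \<in> \<Omega> \<Longrightarrow> winding_number \<gamma> z = s"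
    using simple_closed_path_winding_number_inside[OF \<gamma>(1)] unfolding in\<gamma>
    by (metis neg_equal_0_iff_equal zero_neq_one)
  have hI: "I holomorphic_on \<Omega>"
    unfolding I_def by (rule Cauchy_transform_holomorphic[OF \<gamma>(3) cg \<Omega>(1) \<Omega>P])
  define k where "k = 2 * pi * \<i> * s"
  have "k \<noteq> 0" using s(1) by (simp add: k_def)

  \<comment> \<open>The same singular integral occurs in the limits from both sides. Approaching
    \<open>\<zeta>\<close> from outside, where \<open>I\<close> is explicit and the winding number
    is 0, evaluates it as \<open>c0 / (z0 - \<zeta>)\<close>.\<close>
  have jump: "(\<lambda>n. I (w n)) \<longlonglongrightarrow> k * g \<zeta> + c0 / (z0 - \<zeta>)"
    if \<zeta>: "\<zeta> \<in> frontier \<Omega>" and w: "\<And>n. w n \<in> \<Omega>" "w \<longlonglongrightarrow> \<zeta>" for w \<zeta>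
  proof -
    have \<zeta>\<gamma>: "\<zeta> \<in> path_image \<gamma>" using \<zeta> fr by simp
    have "\<zeta> \<noteq> z0" using \<zeta>\<gamma> z0 \<Omega>P by blast
    have "\<zeta> \<in> closure (outside (path_image \<gamma>))"
      using \<zeta>\<gamma> J unfolding frontier_def by blast
    then obtain w' where w': "\<And>n. w' n \<in> outside (path_image \<gamma>)" "w' \<longlonglongrightarrow> \<zeta>"
      unfolding closure_sequential by blast
    have "winding_number \<gamma> (w' n) = 0" for n
      by (rule winding_number_zero_in_outside) (use \<gamma>(1,2) w'(1) simple_path_imp_path in auto)
    moreover have "w' n \<notin> path_image \<gamma>" for n
      using w'(1) outside_no_overlap by blast
    ultimately have "(\<lambda>n. I (w' n)) \<longlonglongrightarrow> contour_integral \<gamma> (\<lambda>z. (g z - g \<zeta>) / (z - \<zeta>))"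
      using Cauchy_transform_limit[OF \<gamma>(3,1) lip \<zeta>\<gamma>, of w' 0] w'(2) unfolding I_def by simp
    moreover have "(\<lambda>n. I (w' n)) \<longlonglongrightarrow> c0 / (z0 - \<zeta>)"
      unfolding I_out[OF w'(1)] using \<open>\<zeta> \<noteq> z0\<close> by (intro tendsto_intros w'(2)) simp
    ultimately have "contour_integral \<gamma> (\<lambda>z. (g z - g \<zeta>) / (z - \<zeta>)) = c0 / (z0 - \<zeta>)"
      by (rule LIMSEQ_unique)
    moreover have "w n \<notin> path_image \<gamma>" for n using w(1) \<Omega>P by blast
    ultimately show ?thesis
      using Cauchy_transform_limit[OF \<gamma>(3,1) lip \<zeta>\<gamma>, of w s] w s(2) unfolding I_def k_def by simp
  qed

  obtain \<phi> \<psi> where \<phi>: "\<phi> holomorphic_on ball 0 1" "\<phi> 0 = 0" and \<psi>: "\<psi> holomorphic_on \<Omega>"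
    and \<phi>\<psi>: "\<And>t. t \<in> ball 0 1 \<Longrightarrow> \<phi> t \<in> \<Omega> \<and> \<psi> (\<phi> t) = t"
    and \<psi>\<phi>: "\<And>z. z \<in> \<Omega> \<Longrightarrow> \<psi> z \<in> ball 0 1 \<and> \<phi> (\<psi> z) = z"
    by (rule pointed_Riemann_map[OF \<Omega>(1) assms(3) _ assms(5)]) (use \<Omega>(4) not_bounded_UNIV in blast)+
  have bij: "bij_betw \<phi> (ball 0 1) \<Omega>"
    by (rule bij_betw_byWitness[where f' = \<psi>]) (use \<phi>\<psi> \<psi>\<phi> in blast)+
  have \<phi>im: "\<phi> ` ball 0 1 \<subseteq> \<Omega>" using \<phi>\<psi> by blast
  have \<phi>bd: "bounded (\<phi> ` ball 0 1)" using \<phi>im \<Omega>(4) bounded_subset by blast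
  \<comment> \<open>Dividing the jump relation by \<open>k\<close> isolates the weight; the term
    with \<open>w - z0\<close> moves the known outer value to the other side.\<close>
  have lim: "((\<lambda>t. I (\<phi> t) / k + (c0 / k) / (\<phi> t - z0) - 1 / of_real (norm (\<phi> t) ^ (2 * p))) \<longlongrightarrow> 0) disc_boundary"
  proof (rule tendsto_disc_boundaryI[where Q = "\<lambda>w. I w / k + (c0 / k) / (w - z0) - 1 / of_real (norm w ^ (2 * p))"
        and f = \<psi>, OF \<Omega>(1,4) _ _ \<phi>im])
    show "continuous_on \<Omega> \<psi>" by (rule holomorphic_on_imp_continuous_on[OF \<psi>])
    show "\<psi> ` \<Omega> \<subseteq> ball 0 1" using \<psi>\<phi> by blast
    fix w \<zeta> assume w: "\<zeta> \<in> frontier \<Omega>" "\<And>n. w n \<in> \<Omega>" "w \<longlonglongrightarrow> \<zeta>"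
    have "\<zeta> \<noteq> z0" "\<zeta> \<noteq> 0" using w(1) fr z0 assms(5) \<Omega>P by auto
    have "(\<lambda>n. I (w n) / k + (c0 / k) / (w n - z0) - 1 / of_real (norm (w n) ^ (2 * p))) \<longlonglongrightarrow>
        (k * g \<zeta> + c0 / (z0 - \<zeta>)) / k + (c0 / k) / (\<zeta> - z0) - 1 / of_real (norm \<zeta> ^ (2 * p))"
      using \<open>\<zeta> \<noteq> z0\<close> \<open>\<zeta> \<noteq> 0\<close> \<open>k \<noteq> 0\<close> by (intro tendsto_intros jump w) auto
    also have "(k * g \<zeta> + c0 / (z0 - \<zeta>)) / k + (c0 / k) / (\<zeta> - z0) - 1 / of_real (norm \<zeta> ^ (2 * p)) = 0"
    proof -
      have "(c0 / k) / (\<zeta> - z0) = - (c0 / (z0 - \<zeta>) / k)"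
        using minus_divide_right[of "c0 / k" "z0 - \<zeta>"] by (simp add: mult.commute)
      then show ?thesis using \<open>k \<noteq> 0\<close> by (simp add: g_def add_divide_distrib)
    qed
    finally show "(\<lambda>n. I (w n) / k + (c0 / k) / (w n - z0) - 1 / of_real (norm (w n) ^ (2 * p))) \<longlonglongrightarrow> 0" .
  qed (use \<phi>\<psi> in blast)
  have \<zeta>0: "\<psi> z0 \<in> ball 0 1" "\<phi> (\<psi> z0) = z0" using \<psi>\<phi>[OF z0] by blast+
  have lim': "((\<lambda>t. I (\<phi> t) / k + (c0 / k) / (\<phi> t - \<phi> (\<psi> z0)) - 1 / of_real (norm (\<phi> t) ^ (2 * p)))
      \<longlongrightarrow> 0) disc_boundary"
    unfolding \<zeta>0(2) by (rule lim)
  have hG: "(\<lambda>t. I (\<phi> t) / k) holomorphic_on ball 0 1"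
    using holomorphic_on_compose_gen[OF \<phi>(1) hI \<phi>im] \<open>k \<noteq> 0\<close>
    by (intro holomorphic_intros) (simp_all add: o_def)
  obtain \<kappa> \<zeta>1 r where \<kappa>: "\<kappa> \<noteq> 0" and \<zeta>1: "norm \<zeta>1 < 1" and r: "r holomorphic_on ball 0 1"
    and rp: "\<And>t. t \<in> ball 0 1 \<Longrightarrow> r t ^ p = \<kappa> * (1 - cnj (\<psi> z0) * t) / (1 - cnj \<zeta>1 * t)"
    and \<phi>r: "\<And>t. \<phi> t = t * r t"
    by (rule conformal_map_root_form[OF \<phi>(1) bij_betw_imp_inj_on[OF bij] \<phi>(2) \<phi>bd \<zeta>0(1) hG
        lim']) (rule that)
  show "\<exists>a b \<zeta>0 r. norm a > norm b \<and> \<zeta>0 \<in> ball 0 1 \<and>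
            analytic_root_branch p (ball 0 1) (\<lambda>t. (a + b * t) / (1 - t * cnj \<zeta>0)) r \<and>
            conformal_map_onto (\<lambda>t. t * r t) (ball 0 1) \<Omega>"
  \<comment> \<open>The witnesses are \<open>\<kappa>\<close> for \<open>a\<close> and
    \<open>- (\<kappa> * cnj (\<psi> z0))\<close> for \<open>b\<close>, so
    \<open>norm a > norm b\<close> expresses that the preimage of the node lies in the disc. The
    denominator uses \<open>\<zeta>1\<close>, not the preimage \<open>\<psi> z0\<close> of the
    node.\<close>
  proof (intro exI conjI)
    show "norm (- (\<kappa> * cnj (\<psi> z0))) < norm \<kappa>"
      using \<kappa> \<zeta>0(1) by (simp add: norm_mult)
    show "\<zeta>1 \<in> ball 0 1" using \<zeta>1 by simp
    show "analytic_root_branch p (ball 0 1)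
        (\<lambda>t. (\<kappa> + - (\<kappa> * cnj (\<psi> z0)) * t) / (1 - t * cnj \<zeta>1)) r"
      unfolding analytic_root_branch_def using r rp by (simp add: algebra_simps)
    have "\<phi> = (\<lambda>t. t * r t)" using \<phi>r by blast
    then show "conformal_map_onto (\<lambda>t. t * r t) (ball 0 1) \<Omega>"
      unfolding conformal_map_onto_def using \<phi>(1) bij by simp
  qed
qed

end
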